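(* For any integer $m\ge 2$ and any path-connected ANR space $X$, $\mathsf{iTC}_m(X)\le\mathsf{icat}(X^m)$.
   Context: $I=[0,1]$. For a metric space $Z$ and $n\ge 1$, $\mathcal B_n(Z)$ is the space of probability measures on $Z$ whose support has at most $n$ points, written as finite formal convex combinations $\sum\lambda_z z$ with $\lambda_z>0$, $\sum\lambda_z=1$, equipped with the Lévy–Prokhorov metric; $\delta_z$ is the Dirac measure at $z$. $P(Z)$ is the space of continuous paths $I\to Z$ with the compact-open topology. Define $\Phi_n:\mathcal B_n(P(X))\to P(\mathcal B_n(X))$ by $\Phi_n(\sum\lambda_\alpha\alpha)(t)=\sum\lambda_\alpha\alpha(t)$. A path $f\in P(\mathcal B_n(X))$ is resolvable if $f=\Phi_n(\mu)$ for some $\mu\in\mathcal B_n(P(X))$; $RP(\mathcal B_n(X))\subset P(\mathcal B_n(X))$ is the subspace of resolvable paths. Given a basepoint $x_0\in X$, $RP_0(\mathcal B_k(X))=\{f\in RP(\mathcal B_k(X)) : f(1)=\delta_{x_0}\}$. Let $t_i=(i-1)/(m-1)$, $1\le i\le m$. $\mathsf{iTC}_m(X)$ is the minimal integer $n\ge 0$ such that there is a continuous map $s_m:X^m\to RP(\mathcal B_{n+1}(X))$ with $s_m(x_1,\dots,x_m)(t_i)=\delta_{x_i}$ for all $1\le i\le m$ and all $(x_1,\dots,x_m)\in X^m$. $\mathsf{icat}(X)$ is the minimal integer $n\ge 0$ such that there is a continuous $H:X\to RP_0(\mathcal B_{n+1}(X))$ with $H(x)(0)=\delta_x$ for all $x\in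 X$. (Both are infinite if no such $n$ exists.) *)

theory Defs
  imports "HOL-Probability.Probability" "HOL-Library.Extended_Nat"
begin

text \<open>
  A metrizable space is an ANR if it is a neighbourhood retract in every metrizable space that
  contains a homeomorphic copy of it as a closed subset. HOL cannot quantify over the carrier type
  of the ambient space, which is here \<^typ>\<open>'a \<Rightarrow> real\<close>. This loses no ambient space: by
  Kuratowski and Wojdyslawski, a metrizable space with points in \<^typ>\<open>'a\<close> is homeomorphic to a
  closed subset of a convex set of bounded real functions on \<^typ>\<open>'a\<close>, and by Dugundji's
  extension theorem a neighbourhood retract of a convex set in a normed space is a neighbourhood
  retract in every metrizable space containing it as a closed subset. The library constant
  \<^const>\<open>ANR\<close> is not used because its ambient spaces are subspaces of
  \<^typ>\<open>'a \<times> real\<close>, which is adequate only for Euclidean spaces.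
\<close>

definition ANR_space :: "'a topology \<Rightarrow> bool" where
  "ANR_space X \<longleftrightarrow> metrizable_space X \<and>
    (\<forall>(Y :: ('a \<Rightarrow> real) topology) A.
       metrizable_space Y \<and> closedin Y A \<and> X homeomorphic_space (subtopology Y A) \<longrightarrow>
       (\<exists>U. openin Y U \<and> A \<subseteq> U \<and> A retract_of_space (subtopology Y U)))"

text \<open>
  As in \<^const>\<open>product_topology\<close> and \<^const>\<open>funspace\<close>, maps are extensional, so that a
  continuous map is determined by its values on the domain.
\<close>

definition cmaps :: "'a topology \<Rightarrow> 'b topology \<Rightarrow> ('a \<Rightarrow> 'b) set" where
  "cmaps X Y = {f \<in> extensional (topspace X). continuous_map X Y f}"

definition compact_open_topology :: "'a topology \<Rightarrow> 'b topology \<Rightarrow> ('a \<Rightarrow> 'b) topology" where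
  "compact_open_topology X Y =
     topology_generated_by {{f \<in> cmaps X Y. f ` K \<subseteq> U} | K U. compactin X K \<and> openin Y U}"

lemma topspace_compact_open_topology [simp]:
  "topspace (compact_open_topology X Y) = cmaps X Y"
proof -
  have "cmaps X Y \<in> {{f \<in> cmaps X Y. f ` K \<subseteq> U} | K U. compactin X K \<and> openin Y U}"
    by (rule CollectI, rule exI[of _ "{}"], rule exI[of _ "{}"]) auto
  then show ?thesis
    unfolding compact_open_topology_def topology_generated_by_topspace by blast
qed

abbreviation unit_interval :: "real topology" where
  "unit_interval \<equiv> top_of_set {0..1}"

abbreviation paths :: "'a topology \<Rightarrow> (real \<Rightarrow> 'a) set" where
  "paths Z \<equiv> cmaps unit_interval Z"

abbreviation path_topology :: "'a topology \<Rightarrow> (real \<Rightarrow> 'a) topology" where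
  "path_topology Z \<equiv> compact_open_topology unit_interval Z"

text \<open>
  A formal convex combination \<open>\<Sum>\<lambda>\<^sub>z z\<close> with at most \<open>n\<close> terms is a \<^typ>\<open>'a pmf\<close> with at
  most \<open>n\<close> support points; the weights are its point masses, and \<open>\<delta>\<^sub>z\<close> is
  \<^term>\<open>return_pmf z\<close>.
\<close>

definition fin_probs :: "nat \<Rightarrow> 'a set \<Rightarrow> 'a pmf set" where
  "fin_probs n Z = {\<mu>. set_pmf \<mu> \<subseteq> Z \<and> finite (set_pmf \<mu>) \<and> card (set_pmf \<mu>) \<le> n}"

definition borel_sets :: "'a metric \<Rightarrow> 'a set set" where
  "borel_sets Z = sigma_sets (mspace Z) {U. openin (mtopology_of Z) U}"

definition thickening :: "'a metric \<Rightarrow> real \<Rightarrow> 'a set \<Rightarrow> 'a set" where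
  "thickening Z e A = {y \<in> mspace Z. \<exists>a\<in>A. mdist Z a y < e}"

definition LP_set :: "'a metric \<Rightarrow> 'a pmf \<Rightarrow> 'a pmf \<Rightarrow> real set" where
  "LP_set Z \<mu> \<nu> = {e. 0 < e \<and> (\<forall>A \<in> borel_sets Z.
      measure_pmf.prob \<mu> A \<le> measure_pmf.prob \<nu> (thickening Z e A) + e \<and>
      measure_pmf.prob \<nu> A \<le> measure_pmf.prob \<mu> (thickening Z e A) + e)}"

definition LP_dist :: "'a metric \<Rightarrow> 'a pmf \<Rightarrow> 'a pmf \<Rightarrow> real" where
  "LP_dist Z \<mu> \<nu> = Inf (LP_set Z \<mu> \<nu>)"

definition BB :: "nat \<Rightarrow> 'a metric \<Rightarrow> 'a pmf metric" where
  "BB n Z = metric (fin_probs n (mspace Z), LP_dist Z)"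

lemma one_in_LP_set: "1 \<in> LP_set Z \<mu> \<nu>"
  by (auto simp: LP_set_def intro!: add_increasing order.trans[OF measure_pmf.prob_le_1])

lemma bdd_below_LP_set: "bdd_below (LP_set Z \<mu> \<nu>)"
  by (rule bdd_belowI[of _ 0]) (auto simp: LP_set_def)

lemma LP_set_commute: "LP_set Z \<mu> \<nu> = LP_set Z \<nu> \<mu>"
  by (auto simp: LP_set_def)

lemma LP_dist_nonneg: "0 \<le> LP_dist Z \<mu> \<nu>"
  unfolding LP_dist_def
proof (rule cInf_greatest)
  show "LP_set Z \<mu> \<nu> \<noteq> {}" using one_in_LP_set by blast
qed (auto simp: LP_set_def)

lemma borel_sets_subset: "A \<in> borel_sets Z \<Longrightarrow> A \<subseteq> mspace Z"
  unfolding borel_sets_def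
  by (erule sigma_sets_into_sp[rotated]) (force dest: openin_subset)

lemma openin_thickening:
  assumes "A \<subseteq> mspace Z"
  shows "openin (mtopology_of Z) (thickening Z e A)"
proof -
  interpret Metric_space "mspace Z" "mdist Z" by simp
  have "thickening Z e A = (\<Union>a\<in>A. mball a e)"
    using assms by (fastforce simp: thickening_def)
  then show ?thesis
    by (auto simp: mtopology_of_def)
qed

lemma thickening_borel: "A \<subseteq> mspace Z \<Longrightarrow> thickening Z e A \<in> borel_sets Z"
  unfolding borel_sets_def by (intro sigma_sets.Basic CollectI openin_thickening)

lemma singleton_borel:
  assumes "x \<in> mspace Z"
  shows "{x} \<in> borel_sets Z"
proof -
  interpret Metric_space "mspace Z" "mdist Z" by simp
  have "closedin (mtopology_of Z) {x}"
    using assms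
    by (simp add: mtopology_of_def closedin_Hausdorff_singleton Hausdorff_space_mtopology)
  then have "openin (mtopology_of Z) (mspace Z - {x})"
    by (metis openin_diff openin_topspace topspace_mtopology_of)
  then have "mspace Z - (mspace Z - {x}) \<in> borel_sets Z"
    unfolding borel_sets_def by (intro sigma_sets.Compl sigma_sets.Basic) auto
  moreover have "mspace Z - (mspace Z - {x}) = {x}"
    using assms by auto
  ultimately show ?thesis by simp
qed

lemma LP_set_add:
  assumes e: "e \<in> LP_set Z \<mu> \<nu>" and f: "f \<in> LP_set Z \<nu> \<rho>"
  shows "e + f \<in> LP_set Z \<mu> \<rho>"
proof -
  have tri: "thickening Z e' (thickening Z f' A) \<subseteq> thickening Z (e + f) A"
    if "A \<subseteq> mspace Z" "e' + f' = e + f" for A e' f'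
  proof
    fix y assume "y \<in> thickening Z e' (thickening Z f' A)"
    then obtain x a where *: "y \<in> mspace Z" "x \<in> mspace Z" "a \<in> A"
        "mdist Z x y < e'" "mdist Z a x < f'"
      by (auto simp: thickening_def)
    then have "mdist Z a y < e + f"
      using mdist_triangle[of a Z x y] that by force
    then show "y \<in> thickening Z (e + f) A"
      using * by (auto simp: thickening_def)
  qed
  have "measure_pmf.prob \<mu> A \<le> measure_pmf.prob \<rho> (thickening Z (e + f) A) + (e + f) \<and>
        measure_pmf.prob \<rho> A \<le> measure_pmf.prob \<mu> (thickening Z (e + f) A) + (e + f)"
    if A: "A \<in> borel_sets Z" for A
  proof
    have sub: "A \<subseteq> mspace Z" using A by (rule borel_sets_subset)
    have "measure_pmf.prob \<mu> A \<le> measure_pmf.prob \<nu> (thickening Z e A) + e"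
      using e A by (auto simp: LP_set_def)
    also have "measure_pmf.prob \<nu> (thickening Z e A)
        \<le> measure_pmf.prob \<rho> (thickening Z f (thickening Z e A)) + f"
      using f thickening_borel[OF sub] by (auto simp: LP_set_def)
    also have "measure_pmf.prob \<rho> (thickening Z f (thickening Z e A))
        \<le> measure_pmf.prob \<rho> (thickening Z (e + f) A)"
      using tri[OF sub] by (intro measure_pmf.finite_measure_mono) auto
    finally show "measure_pmf.prob \<mu> A \<le> measure_pmf.prob \<rho> (thickening Z (e + f) A) + (e + f)"
      by simp
    have "measure_pmf.prob \<rho> A \<le> measure_pmf.prob \<nu> (thickening Z f A) + f"
      using f A by (auto simp: LP_set_def)
    also have "measure_pmf.prob \<nu> (thickening Z f A)
        \<le> measure_pmf.prob \<mu> (thickening Z e (thickening Z f A)) + e"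
      using e thickening_borel[OF sub] by (auto simp: LP_set_def)
    also have "measure_pmf.prob \<mu> (thickening Z e (thickening Z f A))
        \<le> measure_pmf.prob \<mu> (thickening Z (e + f) A)"
      using tri[OF sub] by (intro measure_pmf.finite_measure_mono) auto
    finally show "measure_pmf.prob \<rho> A \<le> measure_pmf.prob \<mu> (thickening Z (e + f) A) + (e + f)"
      by simp
  qed
  then show ?thesis
    using e f by (auto simp: LP_set_def)
qed

lemma LP_dist_triangle: "LP_dist Z \<mu> \<rho> \<le> LP_dist Z \<mu> \<nu> + LP_dist Z \<nu> \<rho>"
proof (rule field_le_epsilon)
  fix d :: real assume d: "0 < d"
  obtain e where e: "e \<in> LP_set Z \<mu> \<nu>" "e < LP_dist Z \<mu> \<nu> + d / 2"
    using cInf_lessD[of "LP_set Z \<mu> \<nu>" "LP_dist Z \<mu> \<nu> + d / 2"] one_in_LP_set d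
    unfolding LP_dist_def by (metis empty_iff half_gt_zero less_add_same_cancel1)
  obtain f where f: "f \<in> LP_set Z \<nu> \<rho>" "f < LP_dist Z \<nu> \<rho> + d / 2"
    using cInf_lessD[of "LP_set Z \<nu> \<rho>" "LP_dist Z \<nu> \<rho> + d / 2"] one_in_LP_set d
    unfolding LP_dist_def by (metis empty_iff half_gt_zero less_add_same_cancel1)
  have "LP_dist Z \<mu> \<rho> \<le> e + f"
    unfolding LP_dist_def by (rule cInf_lower[OF LP_set_add[OF e(1) f(1)] bdd_below_LP_set])
  then show "LP_dist Z \<mu> \<rho> \<le> LP_dist Z \<mu> \<nu> + LP_dist Z \<nu> \<rho> + d"
    using e f by simp
qed

lemma LP_dist_refl: "set_pmf \<mu> \<subseteq> mspace Z \<Longrightarrow> LP_dist Z \<mu> \<mu> = 0"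
proof (rule antisym[OF _ LP_dist_nonneg], rule field_le_epsilon)
  fix e :: real assume "0 < e" and \<mu>: "set_pmf \<mu> \<subseteq> mspace Z"
  have "A \<subseteq> thickening Z e A" if "A \<in> borel_sets Z" for A
    using borel_sets_subset[OF that] \<open>0 < e\<close> mdist_zero[of _ Z]
    unfolding thickening_def by (smt (verit) mem_Collect_eq subset_iff)
  then have "measure_pmf.prob \<mu> A \<le> measure_pmf.prob \<mu> (thickening Z e A) + e"
    if "A \<in> borel_sets Z" for A
    using measure_pmf.finite_measure_mono[of A "thickening Z e A" \<mu>] that \<open>0 < e\<close> by force
  then have "e \<in> LP_set Z \<mu> \<mu>"
    using \<open>0 < e\<close> by (auto simp: LP_set_def)
  then show "LP_dist Z \<mu> \<mu> \<le> 0 + e"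
    unfolding LP_dist_def using cInf_lower[OF _ bdd_below_LP_set] by simp
qed

lemma LP_dist_0_pmf_le:
  assumes \<nu>: "set_pmf \<nu> \<subseteq> mspace Z" "finite (set_pmf \<nu>)"
    and 0: "LP_dist Z \<mu> \<nu> = 0" and x: "x \<in> mspace Z"
  shows "pmf \<mu> x \<le> pmf \<nu> x"
proof (rule field_le_epsilon)
  fix d :: real assume "0 < d"
  define m where "m = Min (insert d (mdist Z x ` (set_pmf \<nu> - {x})))"
  have fin: "finite (insert d (mdist Z x ` (set_pmf \<nu> - {x})))"
    using \<nu> by simp
  have "mdist Z x y > 0" if "y \<in> set_pmf \<nu> - {x}" for y
    using that \<nu> x mdist_zero[of x Z y] mdist_nonneg[of Z x y]
    by (metis DiffD1 DiffD2 insertI1 order_le_less subsetD)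
  then have "0 < m"
    using \<open>0 < d\<close> fin by (auto simp: m_def)
  obtain e where e: "e \<in> LP_set Z \<mu> \<nu>" "e < m"
    using cInf_lessD[of "LP_set Z \<mu> \<nu>" m] one_in_LP_set \<open>0 < m\<close> 0
    unfolding LP_dist_def by (metis empty_iff)
  have "m \<le> d" "\<And>y. y \<in> set_pmf \<nu> - {x} \<Longrightarrow> m \<le> mdist Z x y"
    using fin by (auto simp: m_def)
  then have sub: "thickening Z e {x} \<inter> set_pmf \<nu> \<subseteq> {x}" and "e < d"
    using e(2) by (force simp: thickening_def)+
  have "pmf \<mu> x = measure_pmf.prob \<mu> {x}"
    by (simp add: measure_pmf_single)
  also have "\<dots> \<le> measure_pmf.prob \<nu> (thickening Z e {x}) + e"
    using e singleton_borel[OF x] by (auto simp: LP_set_def)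
  also have "measure_pmf.prob \<nu> (thickening Z e {x}) =
      measure_pmf.prob \<nu> (thickening Z e {x} \<inter> set_pmf \<nu>)"
    by (simp add: measure_Int_set_pmf)
  also have "\<dots> \<le> measure_pmf.prob \<nu> {x}"
    using sub by (intro measure_pmf.finite_measure_mono) auto
  finally show "pmf \<mu> x \<le> pmf \<nu> x + d"
    using \<open>e < d\<close> by (simp add: measure_pmf_single)
qed

lemma Metric_space_LP: "Metric_space (fin_probs n (mspace Z)) (LP_dist Z)"
proof
  fix \<mu> \<nu> :: "'a pmf"
  show "0 \<le> LP_dist Z \<mu> \<nu>" by (rule LP_dist_nonneg)
  show comm: "LP_dist Z \<mu> \<nu> = LP_dist Z \<nu> \<mu>"
    by (simp add: LP_dist_def LP_set_commute)
  assume \<mu>: "\<mu> \<in> fin_probs n (mspace Z)" and \<nu>: "\<nu> \<in> fin_probs n (mspace Z)"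
  show "LP_dist Z \<mu> \<nu> = 0 \<longleftrightarrow> \<mu> = \<nu>"
  proof
    assume 0: "LP_dist Z \<mu> \<nu> = 0"
    show "\<mu> = \<nu>"
    proof (rule pmf_eqI)
      fix x
      show "pmf \<mu> x = pmf \<nu> x"
      proof (cases "x \<in> mspace Z")
        case True
        then show ?thesis
          using LP_dist_0_pmf_le[of \<nu> Z \<mu> x] LP_dist_0_pmf_le[of \<mu> Z \<nu> x] 0 comm \<mu> \<nu>
          by (auto simp: fin_probs_def)
      next
        case False
        then show ?thesis
          using \<mu> \<nu> unfolding fin_probs_def by (metis (no_types, lifting) mem_Collect_eq set_pmf_iff subsetD)
      qed
    qed
  next
    assume "\<mu> = \<nu>"
    then show "LP_dist Z \<mu> \<nu> = 0"
      using LP_dist_refl \<mu> by (auto simp: fin_probs_def)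
  qed
qed (rule LP_dist_triangle)

lemma mspace_BB [simp]: "mspace (BB n Z) = fin_probs n (mspace Z)"
  and mdist_BB [simp]: "mdist (BB n Z) = LP_dist Z"
  by (simp_all add: BB_def Metric_space.mspace_metric Metric_space.mdist_metric Metric_space_LP)

text \<open>
  The push-forward \<^term>\<open>map_pmf (\<lambda>\<alpha>. \<alpha> t) \<mu>\<close> is \<open>\<Sum>\<lambda>\<^sub>\<alpha> \<alpha>(t)\<close> for \<open>\<mu> = \<Sum>\<lambda>\<^sub>\<alpha> \<alpha>\<close>.
  Resolvability only involves the underlying set of the space of probability measures on the
  path space.
\<close>

definition resolve :: "(real \<Rightarrow> 'a) pmf \<Rightarrow> (real \<Rightarrow> 'a pmf)" where
  "resolve \<mu> = restrict (\<lambda>t. map_pmf (\<lambda>\<alpha>. \<alpha> t) \<mu>) {0..1}"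

definition resolvable_paths :: "nat \<Rightarrow> 'a metric \<Rightarrow> (real \<Rightarrow> 'a pmf) set" where
  "resolvable_paths n X =
     {f \<in> paths (mtopology_of (BB n X)).
        \<exists>\<mu> \<in> fin_probs n (paths (mtopology_of X)). f = resolve \<mu>}"

definition RP :: "nat \<Rightarrow> 'a metric \<Rightarrow> (real \<Rightarrow> 'a pmf) topology" where
  "RP n X = subtopology (path_topology (mtopology_of (BB n X))) (resolvable_paths n X)"

definition RP0 :: "nat \<Rightarrow> 'a metric \<Rightarrow> 'a \<Rightarrow> (real \<Rightarrow> 'a pmf) topology" where
  "RP0 n X x0 = subtopology (RP n X) {f. f 1 = return_pmf x0}"

definition power_topology :: "nat \<Rightarrow> 'a topology \<Rightarrow> (nat \<Rightarrow> 'a) topology" where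
  "power_topology m X = product_topology (\<lambda>_. X) {1..m}"

definition iTC_le :: "nat \<Rightarrow> 'a metric \<Rightarrow> nat \<Rightarrow> bool" where
  "iTC_le m X n \<longleftrightarrow>
     (\<exists>s. continuous_map (power_topology m (mtopology_of X)) (RP (n + 1) X) s \<and>
          (\<forall>x \<in> topspace (power_topology m (mtopology_of X)). \<forall>i \<in> {1..m}.
             s x ((real i - 1) / (real m - 1)) = return_pmf (x i)))"

definition iTC :: "nat \<Rightarrow> 'a metric \<Rightarrow> enat" where
  "iTC m X = (if \<exists>n. iTC_le m X n then enat (LEAST n. iTC_le m X n) else \<infinity>)"

definition icat_le :: "'a metric \<Rightarrow> 'a \<Rightarrow> nat \<Rightarrow> bool" where
  "icat_le X x0 n \<longleftrightarrow>
     (\<exists>H. continuous_map (mtopology_of X) (RP0 (n + 1) X x0) H \<and>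
          (\<forall>x \<in> mspace X. H x 0 = return_pmf x))"

definition icat :: "'a metric \<Rightarrow> 'a \<Rightarrow> enat" where
  "icat X x0 = (if \<exists>n. icat_le X x0 n then enat (LEAST n. icat_le X x0 n) else \<infinity>)"

end

theory Submission
  imports Defs
begin

text \<open>
  Let \<open>H\<close> contract \<open>X\<^sup>m\<close> to \<open>p\<close> through measures, so that \<open>H x\<close> is a random path in \<open>X\<^sup>m\<close> from
  \<open>x\<close> to \<open>p\<close>. Its coordinates are random paths in \<open>X\<close> from \<open>x\<^sub>i\<close> to the fixed point \<open>p\<^sub>i\<close>, and
  \<open>X\<close> being path-connected there are fixed paths joining each \<open>p\<^sub>i\<close> to the next. A single sample
  \<open>\<alpha>\<close> of \<open>H x\<close> thus gives a path that visits \<open>x\<^sub>1, \<dots>, x\<^sub>m\<close> in turn: follow \<open>\<alpha>\<^sub>i\<close> from \<open>x\<^sub>i\<close> to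
  \<open>p\<^sub>i\<close>, cross to the next \<open>p\<^sub>i\<close>, and follow the corresponding coordinate of \<open>\<alpha>\<close> backwards to the
  next \<open>x\<^sub>i\<close>. All pieces use the same sample, so the law of this path is a push-forward of the law of
  \<open>\<alpha>\<close> and its support is no larger than before.

  The resolving measure of \<open>H x\<close> need not depend continuously on \<open>x\<close>, so continuity of the planner
  has to be read off from \<open>H x\<close> itself. This is possible because at each time the concatenated path
  depends on \<open>\<alpha>\<close> through at most one of its values: the planner is at that time either a Dirac
  measure or the image of a value of \<open>H x\<close> under a projection. Hence \<open>map_pmf_itinerary\<close>: applying
  the concatenation to the samples, or directly to the measure-valued coordinates of \<open>H x\<close>, gives
  the same measure-valued path. The first description shows that the planner is resolvable. The
  second one shows that it is continuous, by \<open>continuous_map_itinerary\<close>, once pushing forward is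
  known to be continuous (\<open>continuous_map_map_pmf\<close>) and the exponential law for \<open>[0,1]\<close> allows one to
  argue with maps on \<open>X\<^sup>m \<times> [0,1]\<close> (\<open>continuous_map_eval\<close>, \<open>continuous_map_curry\<close>).
\<close>

section \<open>Push-forwards and Dirac measures in the Levy--Prokhorov metric\<close>

text \<open>
  For probability measures one of the two inequalities suffices: \<open>A\<close> does not meet the thickening of
  the complement of its own thickening, so the second inequality for \<open>A\<close> is the first one for that
  complement.
\<close>

lemma LP_set_one_sidedI:
  assumes "0 < e" "set_pmf \<mu> \<subseteq> mspace Z" "set_pmf \<nu> \<subseteq> mspace Z"
    and le: "\<And>A. A \<in> borel_sets Z \<Longrightarrow>
      measure_pmf.prob \<mu> A \<le> measure_pmf.prob \<nu> (thickening Z e A) + e"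
  shows "e \<in> LP_set Z \<mu> \<nu>"
proof -
  have "measure_pmf.prob \<nu> A \<le> measure_pmf.prob \<mu> (thickening Z e A) + e"
    if A: "A \<in> borel_sets Z" for A
  proof -
    define C where "C = mspace Z - thickening Z e A"
    have "C \<in> borel_sets Z"
      using thickening_borel[OF borel_sets_subset[OF A], of e] 
      unfolding C_def borel_sets_def by (rule sigma_sets.Compl)
    then have "measure_pmf.prob \<mu> C \<le> measure_pmf.prob \<nu> (thickening Z e C) + e"
      by (rule le)
    moreover have "measure_pmf.prob \<nu> A \<le> measure_pmf.prob \<nu> (- thickening Z e C)"
    proof (rule measure_pmf.finite_measure_mono)
      show "A \<subseteq> - thickening Z e C"
        using borel_sets_subset[OF A]
        by (auto simp: C_def thickening_def) (metis mdist_commute)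
    qed simp
    moreover have "measure_pmf.prob \<mu> (thickening Z e A) = measure_pmf.prob \<mu> (- C)"
      using assms(2) by (intro measure_prob_cong_0) (auto simp: C_def thickening_def set_pmf_iff)
    ultimately show ?thesis
      using measure_pmf.prob_compl[of C \<mu>] measure_pmf.prob_compl[of "thickening Z e C" \<nu>]
      by (simp add: Compl_eq_Diff_UNIV)
  qed
  then show ?thesis
    using assms by (auto simp: LP_set_def)
qed

lemma LP_dist_le:
  "e \<in> LP_set Z \<mu> \<nu> \<Longrightarrow> LP_dist Z \<mu> \<nu> \<le> e"
  unfolding LP_dist_def by (rule cInf_lower[OF _ bdd_below_LP_set])

lemma finite_borel:
  assumes "finite F" "F \<subseteq> mspace Z"
  shows "F \<in> borel_sets Z"
  using assms
proof (induction F)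
  case empty
  then show ?case by (simp add: borel_sets_def sigma_sets.Empty)
next
  case (insert x F)
  then have "{x} \<union> F \<in> borel_sets Z"
    using singleton_borel[of x Z] unfolding borel_sets_def
    by (intro sigma_sets_Un) auto
  then show ?case by simp
qed

lemma map_pmf_fin_probs:
  assumes "\<mu> \<in> fin_probs n S" "f ` set_pmf \<mu> \<subseteq> T"
  shows "map_pmf f \<mu> \<in> fin_probs n T"
  using assms card_image_le[of "set_pmf \<mu>" f] by (auto simp: fin_probs_def)

lemma continuous_map_mtopology_of_iff:
  "continuous_map (mtopology_of Y) (mtopology_of Z) f \<longleftrightarrow>
    f ` mspace Y \<subseteq> mspace Z \<and>
    (\<forall>a\<in>mspace Y. \<forall>\<epsilon>>0. \<exists>\<delta>>0. \<forall>x. x \<in> mspace Y \<and> mdist Y a x < \<delta> \<longrightarrow> mdist Z (f a) (f x) < \<epsilon>)"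
  unfolding mtopology_of_def by (rule Metric_space.metric_continuous_map) auto

text \<open>
  The metrics on \<open>X\<^sup>m\<close> are only known up to homeomorphism, so the projections cannot be assumed
  uniformly continuous. Plain continuity is enough, because the measure at which continuity is
  tested has finite support: one modulus \<open>\<delta>\<close> serves all its support points.
\<close>

lemma continuous_map_map_pmf:
  assumes f: "continuous_map (mtopology_of Y) (mtopology_of Z) f"
  shows "continuous_map (mtopology_of (BB n Y)) (mtopology_of (BB n Z)) (map_pmf f)"
  unfolding continuous_map_mtopology_of_iff mspace_BB mdist_BB
proof (intro conjI ballI allI impI)
  have fim: "f ` mspace Y \<subseteq> mspace Z"
    using f unfolding continuous_map_mtopology_of_iff by blast
  show into: "map_pmf f ` fin_probs n (mspace Y) \<subseteq> fin_probs n (mspace Z)"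
  proof clarify
    fix \<mu> assume "\<mu> \<in> fin_probs n (mspace Y)"
    moreover from this have "f ` set_pmf \<mu> \<subseteq> mspace Z"
      using fim by (auto simp: fin_probs_def)
    ultimately show "map_pmf f \<mu> \<in> fin_probs n (mspace Z)"
      by (rule map_pmf_fin_probs)
  qed
  fix \<mu> and \<epsilon> :: real
  assume \<mu>: "\<mu> \<in> fin_probs n (mspace Y)" and "0 < \<epsilon>"
  then have sub: "set_pmf \<mu> \<subseteq> mspace Y" and fin: "finite (set_pmf \<mu>)"
    by (auto simp: fin_probs_def)
  define e where "e = \<epsilon> / 2"
  have "0 < e" "e < \<epsilon>" using \<open>0 < \<epsilon>\<close> by (auto simp: e_def)
  have "\<forall>z\<in>set_pmf \<mu>. \<exists>\<delta>>0. \<forall>y. y \<in> mspace Y \<and> mdist Y z y < \<delta> \<longrightarrow> mdist Z (f z) (f y) < e"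
    using f sub \<open>0 < e\<close> unfolding continuous_map_mtopology_of_iff by blast
  then obtain D where D: "\<And>z. z \<in> set_pmf \<mu> \<Longrightarrow> D z > (0::real)"
    "\<And>z y. z \<in> set_pmf \<mu> \<Longrightarrow> y \<in> mspace Y \<Longrightarrow> mdist Y z y < D z \<Longrightarrow> mdist Z (f z) (f y) < e"
    by metis
  define \<delta> where "\<delta> = Min (insert e (D ` set_pmf \<mu>))"
  have "0 < \<delta>" and \<delta>e: "\<delta> \<le> e" and \<delta>D: "\<And>z. z \<in> set_pmf \<mu> \<Longrightarrow> \<delta> \<le> D z"
    using fin D(1) \<open>0 < e\<close> by (auto simp: \<delta>_def)
  show "\<exists>\<delta>>0. \<forall>\<nu>. \<nu> \<in> fin_probs n (mspace Y) \<and> LP_dist Y \<mu> \<nu> < \<delta> \<longrightarrow>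
      LP_dist Z (map_pmf f \<mu>) (map_pmf f \<nu>) < \<epsilon>"
  proof (intro exI conjI allI impI)
    fix \<nu> assume \<nu>: "\<nu> \<in> fin_probs n (mspace Y) \<and> LP_dist Y \<mu> \<nu> < \<delta>"
    then obtain d where d: "d \<in> LP_set Y \<mu> \<nu>" "d < \<delta>"
      using cInf_lessD[of "LP_set Y \<mu> \<nu>" \<delta>] one_in_LP_set unfolding LP_dist_def by blast
    have "e \<in> LP_set Z (map_pmf f \<mu>) (map_pmf f \<nu>)"
    proof (rule LP_set_one_sidedI)
      show "set_pmf (map_pmf f \<mu>) \<subseteq> mspace Z" "set_pmf (map_pmf f \<nu>) \<subseteq> mspace Z"
        using \<mu> \<nu> fim by (auto simp: fin_probs_def)
      fix A
      \<comment> \<open>Only the support points count, and there \<open>\<delta>\<close> controls \<open>f\<close>; on the whole preimage of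
        \<open>A\<close> it would not.\<close>
      define F where "F = f -` A \<inter> set_pmf \<mu>"
      have "F \<in> borel_sets Y"
        using fin sub by (intro finite_borel) (auto simp: F_def)
      have "measure_pmf.prob (map_pmf f \<mu>) A = measure_pmf.prob \<mu> F"
        by (simp add: F_def measure_Int_set_pmf)
      also have "\<dots> \<le> measure_pmf.prob \<nu> (thickening Y d F) + d"
        using d \<open>F \<in> borel_sets Y\<close> by (auto simp: LP_set_def)
      also have "measure_pmf.prob \<nu> (thickening Y d F) \<le> measure_pmf.prob \<nu> (f -` thickening Z e A)"
      proof (rule measure_pmf.finite_measure_mono)
        show "thickening Y d F \<subseteq> f -` thickening Z e A"
        proof
          fix y assume "y \<in> thickening Y d F"
          then obtain z where z: "y \<in> mspace Y" "z \<in> set_pmf \<mu>" "f z \<in> A" "mdist Y z y < d"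
            by (auto simp: thickening_def F_def)
          then have "mdist Z (f z) (f y) < e"
            using D(2)[of z y] \<delta>D[of z] d(2) by linarith
          then show "y \<in> f -` thickening Z e A"
            using z fim by (auto simp: thickening_def)
        qed
      qed simp
      finally show "measure_pmf.prob (map_pmf f \<mu>) A
          \<le> measure_pmf.prob (map_pmf f \<nu>) (thickening Z e A) + e"
        using d(2) \<delta>e by simp
    qed (fact \<open>0 < e\<close>)
    then show "LP_dist Z (map_pmf f \<mu>) (map_pmf f \<nu>) < \<epsilon>"
      using LP_dist_le \<open>e < \<epsilon>\<close> by force
  qed (fact \<open>0 < \<delta>\<close>)
qed

lemma continuous_map_return_pmf:
  assumes "n \<ge> 1"
  shows "continuous_map (mtopology_of Z) (mtopology_of (BB n Z)) return_pmf"
  unfolding continuous_map_mtopology_of_iff mspace_BB mdist_BB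
proof (intro conjI ballI allI impI)
  show "return_pmf ` mspace Z \<subseteq> fin_probs n (mspace Z)"
    using assms by (auto simp: fin_probs_def)
  fix a and \<epsilon> :: real assume a: "a \<in> mspace Z" and "0 < \<epsilon>"
  show "\<exists>\<delta>>0. \<forall>x. x \<in> mspace Z \<and> mdist Z a x < \<delta> \<longrightarrow>
      LP_dist Z (return_pmf a) (return_pmf x) < \<epsilon>"
  proof (intro exI conjI allI impI)
    show "0 < \<epsilon> / 2" using \<open>0 < \<epsilon>\<close> by simp
    fix x assume x: "x \<in> mspace Z \<and> mdist Z a x < \<epsilon> / 2"
    have "\<epsilon> / 2 \<in> LP_set Z (return_pmf a) (return_pmf x)"
      using x a \<open>0 < \<epsilon>\<close>
      by (intro LP_set_one_sidedI) (auto simp: thickening_def indicator_def)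
    then show "LP_dist Z (return_pmf a) (return_pmf x) < \<epsilon>"
      using LP_dist_le \<open>0 < \<epsilon>\<close> by force
  qed
qed

section \<open>Evaluation and currying for the compact-open topology\<close>

lemma openin_compact_open_subbasic:
  assumes "compactin X K" "openin Y U"
  shows "openin (compact_open_topology X Y) {f \<in> cmaps X Y. f ` K \<subseteq> U}"
  unfolding compact_open_topology_def
  by (rule topology_generated_by_Basis) (use assms in blast)

text \<open>
  Near \<open>(f, x)\<close> one needs a compact neighbourhood of \<open>x\<close> that \<open>f\<close> maps into the given open set:
  the compact set gives the subbasic neighbourhood of \<open>f\<close>, its interior the neighbourhood of \<open>x\<close>.
\<close>

lemma continuous_map_eval:
  assumes X: "neighbourhood_base_of (compactin X) X"
  shows "continuous_map (prod_topology (compact_open_topology X Y) X) Y (\<lambda>(f, x). f x)"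
  unfolding continuous_map_eq_topcontinuous_at topcontinuous_at_def
proof (intro ballI conjI allI impI)
  fix z assume z: "z \<in> topspace (prod_topology (compact_open_topology X Y) X)"
  obtain f x where [simp]: "z = (f, x)" by (cases z)
  have f: "f \<in> cmaps X Y" "continuous_map X Y f" and x: "x \<in> topspace X"
    using z by (auto simp: cmaps_def)
  show "z \<in> topspace (prod_topology (compact_open_topology X Y) X)" by (fact z)
  show "(\<lambda>(f, x). f x) \<in> topspace (prod_topology (compact_open_topology X Y) X) \<rightarrow> topspace Y"
    by (auto simp: cmaps_def continuous_map_def)
  fix V assume V: "openin Y V \<and> (\<lambda>(f, x). f x) z \<in> V"
  have "openin X {y \<in> topspace X. f y \<in> V} \<and> x \<in> {y \<in> topspace X. f y \<in> V}"
    using f V x by (simp add: openin_continuous_map_preimage)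
  then obtain W K where W: "openin X W" "compactin X K" "x \<in> W" "W \<subseteq> K"
      "K \<subseteq> {y \<in> topspace X. f y \<in> V}"
    using X unfolding neighbourhood_base_of by meson
  let ?B = "{g \<in> cmaps X Y. g ` K \<subseteq> V}"
  have "openin (prod_topology (compact_open_topology X Y) X) (?B \<times> W)"
    using W V by (simp add: openin_prod_Times_iff openin_compact_open_subbasic)
  moreover have "z \<in> ?B \<times> W"
    using W f by auto
  moreover have "\<forall>y\<in>?B \<times> W. (\<lambda>(f, x). f x) y \<in> V"
    using W by auto
  ultimately show "\<exists>U. openin (prod_topology (compact_open_topology X Y) X) U \<and> z \<in> U \<and>
      (\<forall>y\<in>U. (\<lambda>(f, x). f x) y \<in> V)"
    by blast
qed

text \<open>
  If \<open>h t\<close> maps the compact set \<open>K\<close> into \<open>U\<close>, the tube lemma thickens \<open>{t} \<times> K\<close> inside the preimage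
  of \<open>U\<close>, so the same holds for all parameters near \<open>t\<close>.
\<close>

lemma continuous_map_curry:
  assumes h: "continuous_map (prod_topology T X) Y (\<lambda>(t, x). h t x)"
  shows "continuous_map T (compact_open_topology X Y) (\<lambda>t. restrict (h t) (topspace X))"
  unfolding compact_open_topology_def
proof (rule continuous_on_generated_topo)
  let ?S = "{{f \<in> cmaps X Y. f ` K \<subseteq> U} |K U. compactin X K \<and> openin Y U}"
  have "continuous_map X Y (h t)" if "t \<in> topspace T" for t
  proof -
    have "continuous_map X (prod_topology T X) (\<lambda>x. (t, x))"
      using that by (simp add: continuous_map_pairwise o_def)
    from continuous_map_compose[OF this h] show ?thesis
      by (simp add: o_def)
  qed
  then have cm: "restrict (h t) (topspace X) \<in> cmaps X Y" if "t \<in> topspace T" for t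
    using that by (auto simp: cmaps_def intro: continuous_map_eq)
  have "\<Union>?S = cmaps X Y"
    using topspace_compact_open_topology[of X Y]
    unfolding compact_open_topology_def topology_generated_by_topspace .
  then show "(\<lambda>t. restrict (h t) (topspace X)) ` topspace T \<subseteq> \<Union>?S"
    using cm by auto
  fix B assume "B \<in> ?S"
  then obtain K U where B: "B = {f \<in> cmaps X Y. f ` K \<subseteq> U}" and K: "compactin X K" and U: "openin Y U"
    by blast
  have KX: "K \<subseteq> topspace X" by (rule compactin_subset_topspace[OF K])
  let ?W = "{z \<in> topspace (prod_topology T X). (\<lambda>(t, x). h t x) z \<in> U}"
  have W: "openin (prod_topology T X) ?W"
    using h U by (rule openin_continuous_map_preimage)
  show "openin T ((\<lambda>t. restrict (h t) (topspace X)) -` B \<inter> topspace T)"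
  proof (subst openin_subopen, intro ballI)
    fix t assume t: "t \<in> (\<lambda>t. restrict (h t) (topspace X)) -` B \<inter> topspace T"
    have "{t} \<times> K \<subseteq> ?W"
      using t KX by (auto simp: B image_subset_iff subset_iff)
    moreover have "t \<in> topspace T" using t by simp
    ultimately obtain V V' where V: "openin T V" "t \<in> V" "K \<subseteq> V'" "V \<times> V' \<subseteq> ?W"
      using tube_lemma_right[OF W K] by meson
    have "V \<subseteq> (\<lambda>t. restrict (h t) (topspace X)) -` B \<inter> topspace T"
    proof
      fix t' assume t': "t' \<in> V"
      then have "t' \<in> topspace T" using openin_subset[OF V(1)] by blast
      moreover have "h t' x \<in> U" if "x \<in> K" for x
      proof -
        have "(t', x) \<in> ?W" using V t' that by blast
        then show ?thesis by simp
      qed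
      ultimately show "t' \<in> (\<lambda>t. restrict (h t) (topspace X)) -` B \<inter> topspace T"
        using KX cm by (auto simp: B)
    qed
    with V show "\<exists>V. openin T V \<and> t \<in> V \<and> V \<subseteq> (\<lambda>t. restrict (h t) (topspace X)) -` B \<inter> topspace T"
      by blast
  qed
qed

section \<open>Itineraries\<close>

text \<open>
  Time is rescaled to \<open>[0,k]\<close>, so that stop \<open>j\<close> is made at time \<open>j\<close>. Within a third of a unit around
  \<open>j\<close> the traveller moves on spoke \<open>a j\<close>, which is at its outer end (parameter \<open>0\<close>) at time \<open>j\<close> and
  at its inner end (parameter \<open>1\<close>) at the times \<open>j - 1/3\<close> and \<open>j + 1/3\<close>: it is run through inwards
  after the stop and outwards before it. The middle third of \<open>[j, j+1]\<close> is spent on the bridge \<open>g j\<close>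
  between the inner ends of two successive spokes. The parameters are clamped to \<open>[0,1]\<close>, which makes
  every piece defined and continuous for all times and not just on its own interval.
\<close>

definition spoke :: "nat \<Rightarrow> real \<Rightarrow> real" where
  "spoke j u = min 1 (3 * \<bar>u - real j\<bar>)"

definition bridge :: "nat \<Rightarrow> real \<Rightarrow> real" where
  "bridge j u = max 0 (min 1 (3 * (u - real j) - 1))"

primrec itinerary :: "(nat \<Rightarrow> real \<Rightarrow> 'a) \<Rightarrow> (nat \<Rightarrow> real \<Rightarrow> 'a) \<Rightarrow> nat \<Rightarrow> real \<Rightarrow> 'a" where
  "itinerary a g 0 u = a 0 (spoke 0 u)"
| "itinerary a g (Suc k) u =
    (if u \<le> real k + 1/3 then itinerary a g k u
     else if u \<le> real k + 2/3 then g k (bridge k u)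
     else a (Suc k) (spoke (Suc k) u))"

lemma spoke_in_unit_interval: "spoke j u \<in> {0..1}"
  by (auto simp: spoke_def)

lemma continuous_map_spoke:
  assumes "continuous_map P euclideanreal u"
  shows "continuous_map P unit_interval (\<lambda>z. spoke j (u z))"
  using assms unfolding spoke_def
  by (intro continuous_map_into_subtopology continuous_intros) (auto simp: min_def)

lemma continuous_map_bridge:
  assumes "continuous_map P euclideanreal u"
  shows "continuous_map P unit_interval (\<lambda>z. bridge j (u z))"
  using assms unfolding bridge_def
  by (intro continuous_map_into_subtopology continuous_intros) auto

lemma itinerary_final: "real k + 1/3 \<le> u \<Longrightarrow> itinerary a g k u = a k 1"
  by (cases k) (auto simp: spoke_def min_def)

lemma itinerary_at: "j \<le> k \<Longrightarrow> itinerary a g k (real j) = a j 0"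
proof (induction k)
  case (Suc k)
  show ?case
  proof (cases "j = Suc k")
    case False
    then have "j \<le> k" using Suc.prems by simp
    then have "real j \<le> real k + 1/3" by simp
    then show ?thesis using Suc.IH \<open>j \<le> k\<close> by simp
  qed (simp add: spoke_def)
qed (simp add: spoke_def)

text \<open>
  The spokes may vary with a parameter \<open>z\<close>, but their inner ends and the bridges may not. The
  continuity assumption on a spoke is about its composition with the clock \<open>u\<close>, so that it covers
  both a clock that is the parameter itself and one that is a coordinate of the parameter.
\<close>

lemma continuous_map_itinerary:
  assumes u: "continuous_map P euclideanreal u"
    and a: "\<And>j. j \<le> k \<Longrightarrow> continuous_map P Y (\<lambda>z. a z j (spoke j (u z)))"
    and g: "\<And>j. j < k \<Longrightarrow> pathin Y (g j)"
    and start: "\<And>j z. j < k \<Longrightarrow> z \<in> topspace P \<Longrightarrow> a z j 1 = g j 0"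
    and finish: "\<And>j z. j < k \<Longrightarrow> z \<in> topspace P \<Longrightarrow> a z (Suc j) 1 = g j 1"
  shows "continuous_map P Y (\<lambda>z. itinerary (a z) g k (u z))"
  using a g start finish
proof (induction k)
  case 0
  then show ?case by simp
next
  case (Suc k)
  have IH: "continuous_map P Y (\<lambda>z. itinerary (a z) g k (u z))"
    by (rule Suc.IH; rule Suc.prems; simp)
  have G: "continuous_map P Y (\<lambda>z. g k (bridge k (u z)))"
    using continuous_map_compose[OF continuous_map_bridge[OF u] Suc.prems(2)[unfolded pathin_def], of k k]
    by (simp add: o_def)
  have A: "continuous_map P Y (\<lambda>z. a z (Suc k) (spoke (Suc k) (u z)))"
    by (simp add: Suc.prems(1))
  have GA: "continuous_map P Y (\<lambda>z. if u z \<le> real k + 2/3 then g k (bridge k (u z))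
      else a z (Suc k) (spoke (Suc k) (u z)))"
  proof (rule continuous_map_cases_le[OF u])
    fix z assume z: "z \<in> topspace P" "u z = real k + 2/3"
    show "g k (bridge k (u z)) = a z (Suc k) (spoke (Suc k) (u z))"
      using z Suc.prems(4)[of k z] by (simp add: bridge_def spoke_def)
  qed (simp_all add: continuous_map_from_subtopology G A)
  show ?case
    unfolding itinerary.simps
  proof (rule continuous_map_cases_le[OF u])
    fix z assume z: "z \<in> topspace P" "u z = real k + 1/3"
    show "itinerary (a z) g k (u z) =
        (if u z \<le> real k + 2/3 then g k (bridge k (u z)) else a z (Suc k) (spoke (Suc k) (u z)))"
      using z Suc.prems(3)[of k z] itinerary_final[of k "u z" "a z" g] by (simp add: bridge_def)
  qed (simp_all add: continuous_map_from_subtopology IH GA)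
qed

text \<open>
  At any given time the itinerary uses one value of one spoke or bridge, so the law of the
  position at that time depends only on the laws of the individual spoke values, and not on how these
  are correlated.
\<close>

lemma map_pmf_itinerary:
  assumes "\<And>j \<tau>. j \<le> k \<Longrightarrow> \<tau> \<in> {0..1} \<Longrightarrow> map_pmf (\<lambda>\<alpha>. a \<alpha> j \<tau>) \<mu> = b j \<tau>"
  shows "map_pmf (\<lambda>\<alpha>. itinerary (a \<alpha>) g k u) \<mu> = itinerary b (\<lambda>j s. return_pmf (g j s)) k u"
  using assms by (induction k) (simp_all add: spoke_in_unit_interval del: atLeastAtMost_iff)

section \<open>From contractions of the power to motion planners\<close>

lemma neighbourhood_base_unit_interval: "neighbourhood_base_of (compactin unit_interval) unit_interval"
proof -
  have "locally_compact_space unit_interval"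
    by (rule compact_imp_locally_compact_space) (simp add: compact_space_subtopology)
  then show ?thesis
    by (simp add: locally_compact_space_neighbourhood_base Hausdorff_space_subtopology)
qed

lemma iTC_le_if_icat_le:
  fixes X :: "'a metric" and Xm :: "(nat \<Rightarrow> 'a) metric"
  assumes m: "m \<ge> 2"
    and pc: "path_connected_space (mtopology_of X)"
    and Xm: "mtopology_of Xm = power_topology m (mtopology_of X)"
    and p: "p \<in> mspace Xm"
    and icat: "icat_le Xm p n"
  shows "iTC_le m X n"
proof -
  let ?I = unit_interval and ?X = "mtopology_of X" and ?Xm = "mtopology_of Xm"
    and ?B = "mtopology_of (BB (n + 1) X)" and ?Bm = "mtopology_of (BB (n + 1) Xm)"
  define k where "k = m - 1"
  have mk: "real m - 1 = real k" "k > 0" using m by (auto simp: k_def of_nat_diff)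
  obtain H where H: "continuous_map ?Xm (RP0 (n + 1) Xm p) H"
    and H0: "\<And>x. x \<in> mspace Xm \<Longrightarrow> H x 0 = return_pmf x"
    using icat unfolding icat_le_def by blast
  have Hcont: "continuous_map ?Xm (path_topology ?Bm) H"
    and Hres: "\<And>x. x \<in> mspace Xm \<Longrightarrow> H x \<in> resolvable_paths (n + 1) Xm"
    and H1: "\<And>x. x \<in> mspace Xm \<Longrightarrow> H x 1 = return_pmf p"
    using H unfolding RP0_def RP_def continuous_map_in_subtopology by auto
  have coord: "continuous_map ?Xm ?X (\<lambda>y. y (Suc j))" if "j \<le> k" for j
    unfolding Xm power_topology_def using that m
    by (intro continuous_map_product_coordinates) (auto simp: k_def)
  have p_in: "p (Suc j) \<in> mspace X" if "j \<le> k" for j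
    using coord[OF that] p by (auto simp: continuous_map_def)
  have "\<exists>g. pathin ?X g \<and> g 0 = p (Suc j) \<and> g 1 = p (Suc (Suc j))" if "j < k" for j
    using pc p_in[of j] p_in[of "Suc j"] that unfolding path_connected_space_def by simp
  then obtain g where g: "\<And>j. j < k \<Longrightarrow> pathin ?X (g j)"
    and g0: "\<And>j. j < k \<Longrightarrow> g j 0 = p (Suc j)"
    and g1: "\<And>j. j < k \<Longrightarrow> g j 1 = p (Suc (Suc j))"
    by metis
  \<comment> \<open>Spoke \<open>j\<close> is coordinate \<open>j + 1\<close>, since stops are counted from \<open>0\<close> and coordinates from \<open>1\<close>.\<close>
  define b where "b x j \<tau> = map_pmf (\<lambda>y. y (Suc j)) (H x \<tau>)" for x j \<tau>
  define h where "h x t = itinerary (b x) (\<lambda>j s. return_pmf (g j s)) k (real k * t)" for x t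
  have h_cont: "continuous_map (prod_topology ?Xm ?I) ?B (\<lambda>(x, t). h x t)"
  proof -
    let ?P = "prod_topology ?Xm ?I"
    have u: "continuous_map ?P euclideanreal (\<lambda>z. real k * snd z)"
      using continuous_map_snd[of ?Xm ?I] 
      by (intro continuous_map_real_mult_left) (rule continuous_map_into_fulltopology)
    have "continuous_map ?P ?B (\<lambda>z. itinerary (b (fst z)) (\<lambda>j s. return_pmf (g j s)) k (real k * snd z))"
    proof (rule continuous_map_itinerary[OF u])
      fix j assume j: "j \<le> k"
      have "continuous_map ?P (prod_topology (path_topology ?Bm) ?I)
          (\<lambda>z. (H (fst z), spoke j (real k * snd z)))"
        using continuous_map_compose[OF continuous_map_fst Hcont, of ?I] continuous_map_spoke[OF u]
        by (simp add: continuous_map_pairwise o_def)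
      from continuous_map_compose[OF this
          continuous_map_compose[OF continuous_map_eval[OF neighbourhood_base_unit_interval]
            continuous_map_map_pmf[OF coord[OF j]]]]
      show "continuous_map ?P ?B (\<lambda>z. b (fst z) j (spoke j (real k * snd z)))"
        by (simp add: o_def b_def)
    next
      fix j assume j: "j < k"
      show "pathin ?B (\<lambda>s. return_pmf (g j s))"
        using pathin_compose[OF g[OF j] continuous_map_return_pmf] by (simp add: o_def)
      fix z assume z: "z \<in> topspace ?P"
      show "b (fst z) j 1 = return_pmf (g j 0)" "b (fst z) (Suc j) 1 = return_pmf (g j 1)"
        using z j by (auto simp: b_def H1 g0 g1)
    qed
    then show ?thesis
      by (simp add: h_def case_prod_unfold)
  qed
  define s where "s x = restrict (h x) {0..1}" for x
  have s_cont: "continuous_map ?Xm (path_topology ?B) s"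
    using continuous_map_curry[OF h_cont] by (simp add: s_def[abs_def])
  have s_res: "s x \<in> resolvable_paths (n + 1) X" if x: "x \<in> mspace Xm" for x
  proof -
    obtain \<mu> where \<mu>: "\<mu> \<in> fin_probs (n + 1) (paths ?Xm)" and Hx: "H x = resolve \<mu>"
      using Hres[OF x] unfolding resolvable_paths_def by blast
    define c where "c \<alpha> t = itinerary (\<lambda>j \<tau>. \<alpha> \<tau> (Suc j)) g k (real k * t)" for \<alpha> :: "real \<Rightarrow> nat \<Rightarrow> 'a" and t
    have c_path: "restrict (c \<alpha>) {0..1} \<in> paths ?X" if \<alpha>: "\<alpha> \<in> set_pmf \<mu>" for \<alpha>
    proof -
      have \<alpha>_cont: "continuous_map ?I ?Xm \<alpha>"
        using \<alpha> \<mu> by (auto simp: fin_probs_def cmaps_def)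
      \<comment> \<open>A mixture that is a Dirac measure at time \<open>1\<close> consists of paths that all end at \<open>p\<close>, so each
        sample fits the fixed bridges.\<close>
      have "map_pmf (\<lambda>\<alpha>. \<alpha> 1) \<mu> = return_pmf p"
        using H1[OF x] by (simp add: Hx resolve_def)
      then have "(\<lambda>\<alpha>. \<alpha> 1) ` set_pmf \<mu> = {p}"
        by (metis set_map_pmf set_return_pmf)
      then have \<alpha>1: "\<alpha> 1 = p" using \<alpha> by blast
      have u: "continuous_map ?I euclideanreal (\<lambda>t. real k * t)"
        by (simp add: continuous_on_mult_left)
      have "continuous_map ?I ?X (\<lambda>t. itinerary (\<lambda>j \<tau>. \<alpha> \<tau> (Suc j)) g k (real k * t))"
      proof (rule continuous_map_itinerary[OF u])
        fix j assume "j \<le> k"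
        then show "continuous_map ?I ?X (\<lambda>t. \<alpha> (spoke j (real k * t)) (Suc j))"
          using continuous_map_compose[OF continuous_map_compose[OF continuous_map_spoke[OF u] \<alpha>_cont] coord]
          by (simp add: o_def)
      qed (auto simp: g g0 g1 \<alpha>1)
      then show ?thesis
        by (auto simp: cmaps_def c_def[abs_def] intro: continuous_map_eq)
    qed
    define \<nu> where "\<nu> = map_pmf (\<lambda>\<alpha>. restrict (c \<alpha>) {0..1}) \<mu>"
    have "\<nu> \<in> fin_probs (n + 1) (paths ?X)"
      unfolding \<nu>_def using c_path by (intro map_pmf_fin_probs[OF \<mu>]) auto
    moreover have "s x = resolve \<nu>"
    proof
      fix t
      have "map_pmf (\<lambda>\<alpha>. c \<alpha> t) \<mu> = h x t"
        unfolding c_def h_def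
        by (rule map_pmf_itinerary) (simp add: b_def Hx resolve_def pmf.map_comp o_def)
      then show "s x t = resolve \<nu> t"
        by (simp add: s_def resolve_def \<nu>_def pmf.map_comp o_def restrict_def)
    qed
    moreover have "s x \<in> paths ?B"
      using s_cont x by (auto simp: continuous_map_def)
    ultimately show ?thesis
      unfolding resolvable_paths_def by blast
  qed
  have "s x ((real i - 1) / (real m - 1)) = return_pmf (x i)"
    if x: "x \<in> mspace Xm" and i: "i \<in> {1..m}" for x i
  proof -
    define j where "j = i - 1"
    have j: "i = Suc j" "j \<le> k" using i by (auto simp: j_def k_def)
    then have "s x ((real i - 1) / (real m - 1)) = h x (real j / real k)"
      using mk by (simp add: s_def)
    also have "\<dots> = b x j 0"
      using mk(2) j by (simp add: h_def itinerary_at)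
    also have "\<dots> = return_pmf (x i)"
      using x j by (simp add: b_def H0)
    finally show ?thesis .
  qed
  moreover have "continuous_map ?Xm (RP (n + 1) X) s"
    unfolding RP_def using s_cont s_res by (intro continuous_map_into_subtopology) auto
  moreover have "topspace (power_topology m ?X) = mspace Xm"
    by (metis Xm topspace_mtopology_of)
  ultimately show ?thesis
    unfolding iTC_le_def Xm[symmetric] by auto
qed

theorem proposition4p18:
  fixes X :: "'a metric" and Xm :: "(nat \<Rightarrow> 'a) metric"
    and m :: nat and p :: "nat \<Rightarrow> 'a"
  assumes "m \<ge> 2"
    and "path_connected_space (mtopology_of X)"
    and "ANR_space (mtopology_of X)"
    and "mtopology_of Xm = power_topology m (mtopology_of X)"
    and "p \<in> mspace Xm"
  shows "iTC m X \<le> icat Xm p"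
proof (cases "\<exists>n. icat_le Xm p n")
  case True
  then have "icat_le Xm p (LEAST n. icat_le Xm p n)"
    by (rule LeastI_ex)
  then have "iTC_le m X (LEAST n. icat_le Xm p n)"
    using iTC_le_if_icat_le assms by blast
  then show ?thesis
    using True by (auto simp: iTC_def icat_def intro: Least_le)
next
  case False
  then show ?thesis by (simp add: icat_def)
qed

end
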